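(* Let $n$ be a positive integer and let $\mathbb{F}_q$ be the finite field with $q$ elements. If $q\le n-2$, then the Catalan matroid $\mathbf{C}_n$ is not representable over $\mathbb{F}_q$.
   Context: A Dyck path of length $2n$ is a path in the plane from $(0,0)$ to $(2n,0)$, with steps $(1,1)$ (up-steps) and $(1,-1)$ (down-steps), that never passes below the $x$-axis. Its up-step set is the set of $i\in[2n]=\{1,\dots,2n\}$ for which the $i$-th step is an up-step. The Catalan matroid $\mathbf{C}_n$ is the matroid on the ground set $[2n]$ whose bases are the up-step sets of all Dyck paths of length $2n$. A matroid is representable over a field if it is isomorphic to the vector matroid of a finite indexed family of vectors in a vector space over that field. *)

theory Defs
  imports Complex_Main "HOL-Library.Cardinality"
begin

section \<open>Matroids given by their bases\<close>

record 'a matroid_data =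
  ground :: "'a set"
  bases :: "'a set set"

definition is_matroid :: "'a matroid_data \<Rightarrow> bool" where
  "is_matroid M \<longleftrightarrow>
     finite (ground M) \<and> bases M \<noteq> {} \<and> bases M \<subseteq> Pow (ground M) \<and>
     (\<forall>A\<in>bases M. \<forall>B\<in>bases M. \<forall>x\<in>A - B. \<exists>y\<in>B - A. insert y (A - {x}) \<in> bases M)"

definition matroid_iso :: "'a matroid_data \<Rightarrow> 'b matroid_data \<Rightarrow> bool" where
  "matroid_iso M N \<longleftrightarrow>
     (\<exists>f. bij_betw f (ground M) (ground N) \<and>
          (\<forall>X. X \<subseteq> ground M \<longrightarrow> (X \<in> bases M \<longleftrightarrow> f ` X \<in> bases N)))"

section \<open>Vector matroids and representability\<close>

text \<open>Linear independence of the subfamily of \<open>v\<close> indexed by \<open>J\<close>. Injectivity is needed because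
  a family that repeats a vector is dependent, although its set of values need not be.\<close>

definition indep_family ::
    "('k::field \<Rightarrow> 'v::ab_group_add \<Rightarrow> 'v) \<Rightarrow> ('i \<Rightarrow> 'v) \<Rightarrow> 'i set \<Rightarrow> bool" where
  "indep_family scale v J \<longleftrightarrow> inj_on v J \<and> \<not> module.dependent scale (v ` J)"

definition vector_matroid ::
    "('k::field \<Rightarrow> 'v::ab_group_add \<Rightarrow> 'v) \<Rightarrow> 'i set \<Rightarrow> ('i \<Rightarrow> 'v) \<Rightarrow> 'i matroid_data" where
  "vector_matroid scale I v =
     \<lparr>ground = I,
      bases = {J. J \<subseteq> I \<and> indep_family scale v J \<and>
                  (\<forall>J'. J' \<subseteq> I \<and> indep_family scale v J' \<and> J \<subseteq> J' \<longrightarrow> J' = J)}\<rparr>"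

text \<open>HOL cannot quantify existentially over types, so the type \<open>'v\<close> carrying the vector space is
  a parameter; \<open>M\<close> is representable over \<open>'k\<close> iff this holds for some \<open>'v\<close>, and it is not
  representable over \<open>'k\<close> iff the negation holds for all \<open>'v\<close>. As every finite family can be
  reindexed by natural numbers, index sets are taken in \<open>nat\<close>.\<close>

definition representable_over ::
    "'k::field itself \<Rightarrow> 'v::ab_group_add itself \<Rightarrow> 'a matroid_data \<Rightarrow> bool" where
  "representable_over K V M \<longleftrightarrow>
     (\<exists>(scale :: 'k \<Rightarrow> 'v \<Rightarrow> 'v) (I :: nat set) (v :: nat \<Rightarrow> 'v).
        vector_space scale \<and> finite I \<and> matroid_iso M (vector_matroid scale I v))"

section \<open>Dyck paths and the Catalan matroid\<close>

text \<open>A lattice path starting at the origin is given by its list of steps, \<open>Up = (1,1)\<close> and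
  \<open>Down = (1,-1)\<close>; after \<open>k\<close> steps it is at the point \<open>(k, height s k)\<close>.\<close>

datatype step = Up | Down

fun rise :: "step \<Rightarrow> int" where
  "rise Up = 1"
| "rise Down = -1"

definition height :: "step list \<Rightarrow> nat \<Rightarrow> int" where
  "height s k = (\<Sum>i<k. rise (s ! i))"

definition dyck_path :: "nat \<Rightarrow> step list \<Rightarrow> bool" where
  "dyck_path n s \<longleftrightarrow>
     length s = 2 * n \<and> height s (2 * n) = 0 \<and> (\<forall>k\<le>2 * n. 0 \<le> height s k)"

text \<open>Steps are numbered from 1, list positions from 0.\<close>

definition up_step_set :: "step list \<Rightarrow> nat set" where
  "up_step_set s = {i \<in> {1..length s}. s ! (i - 1) = Up}"

definition catalan_matroid :: "nat \<Rightarrow> nat matroid_data" where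
  "catalan_matroid n =
     \<lparr>ground = {1..2 * n}, bases = {up_step_set s | s. dyck_path n s}\<rparr>"

section \<open>Both constructions yield matroids\<close>

lemma height_eq_card:
  assumes "k \<le> length s"
  shows "height s k = 2 * int (card (up_step_set s \<inter> {1..k})) - int k"
  using assms
proof (induction k)
  case 0
  then show ?case by (simp add: height_def)
next
  case (Suc k)
  have "up_step_set s \<inter> {1..Suc k} =
      (if s ! k = Up then insert (Suc k) (up_step_set s \<inter> {1..k}) else up_step_set s \<inter> {1..k})"
    using Suc.prems by (auto simp: up_step_set_def le_Suc_eq)
  moreover have "rise (s ! k) = (if s ! k = Up then 1 else -1)"
    by (cases "s ! k") auto
  ultimately show ?case
    using Suc by (auto simp: height_def)
qed

lemma catalan_bases_iff:
  "X \<in> bases (catalan_matroid n) \<longleftrightarrow>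
     X \<subseteq> {1..2 * n} \<and> card X = n \<and> (\<forall>k\<le>2 * n. k \<le> 2 * card (X \<inter> {1..k}))"
proof
  assume "X \<in> bases (catalan_matroid n)"
  then obtain s where s: "X = up_step_set s" "dyck_path n s"
    by (auto simp: catalan_matroid_def)
  have sub: "X \<subseteq> {1..2 * n}" and len: "length s = 2 * n"
    using s by (auto simp: up_step_set_def dyck_path_def)
  have h: "height s k = 2 * int (card (X \<inter> {1..k})) - int k" if "k \<le> 2 * n" for k
    using height_eq_card[of k s] that s len by simp
  have "X \<inter> {1..2 * n} = X" using sub by blast
  then have "card X = n"
    using h[of "2 * n"] s(2) by (simp add: dyck_path_def)
  moreover have "k \<le> 2 * card (X \<inter> {1..k})" if "k \<le> 2 * n" for k
  proof -
    have "0 \<le> height s k" using s(2) that by (simp add: dyck_path_def)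
    then show ?thesis using h[OF that] by linarith
  qed
  ultimately show "X \<subseteq> {1..2 * n} \<and> card X = n \<and> (\<forall>k\<le>2 * n. k \<le> 2 * card (X \<inter> {1..k}))"
    using sub by blast
next
  assume *: "X \<subseteq> {1..2 * n} \<and> card X = n \<and> (\<forall>k\<le>2 * n. k \<le> 2 * card (X \<inter> {1..k}))"
  define s where "s = map (\<lambda>i. if Suc i \<in> X then Up else Down) [0..<2 * n]"
  have len: "length s = 2 * n" by (simp add: s_def)
  have "i \<in> up_step_set s \<longleftrightarrow> i \<in> X" for i
    using * by (cases i) (auto simp: up_step_set_def s_def split: if_splits)
  then have X: "up_step_set s = X" by blast
  have h: "height s k = 2 * int (card (X \<inter> {1..k})) - int k" if "k \<le> 2 * n" for k
    using height_eq_card[of k s] that X len by simp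
  have "X \<inter> {1..2 * n} = X" using * by blast
  then have "height s (2 * n) = 0" using h[of "2 * n"] * by simp
  moreover have "0 \<le> height s k" if "k \<le> 2 * n" for k
    using h[OF that] * that by force
  ultimately have "dyck_path n s" using len by (simp add: dyck_path_def)
  then show "X \<in> bases (catalan_matroid n)" using X by (auto simp: catalan_matroid_def)
qed

lemma is_matroid_catalan: "is_matroid (catalan_matroid n)"
  unfolding is_matroid_def
proof (intro conjI ballI)
  show "finite (ground (catalan_matroid n))" by (simp add: catalan_matroid_def)
  show "bases (catalan_matroid n) \<subseteq> Pow (ground (catalan_matroid n))"
    by (auto simp: catalan_matroid_def up_step_set_def dyck_path_def)
  have "{1..n} \<in> bases (catalan_matroid n)"
    unfolding catalan_bases_iff
  proof (intro conjI allI impI)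
    fix k assume "k \<le> 2 * n"
    have "{1..n} \<inter> {1..k} = {1..min n k}" by auto
    then show "k \<le> 2 * card ({1..n} \<inter> {1..k})" using \<open>k \<le> 2 * n\<close> by simp
  qed auto
  then show "bases (catalan_matroid n) \<noteq> {}" by blast
next
  fix A B x
  assume A: "A \<in> bases (catalan_matroid n)" and B: "B \<in> bases (catalan_matroid n)"
    and x: "x \<in> A - B"
  note A' = A[unfolded catalan_bases_iff] and B' = B[unfolded catalan_bases_iff]
  have fin: "finite A" "finite B" using A' B' finite_subset by blast+
  have "B - A \<noteq> {}"
  proof
    assume "B - A = {}"
    then have "B = A" using A' B' fin by (intro card_subset_eq) auto
    then show False using x by blast
  qed
  define y where "y = Min (B - A)"
  have y: "y \<in> B - A" using \<open>B - A \<noteq> {}\<close> fin unfolding y_def by (intro Min_in) auto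
  have ymin: "y \<le> z" if "z \<in> B - A" for z
    using that fin unfolding y_def by (intro Min_le) auto
  let ?C = "insert y (A - {x})"
  have "?C \<in> bases (catalan_matroid n)"
    unfolding catalan_bases_iff
  proof (intro conjI allI impI)
    show "?C \<subseteq> {1..2 * n}" using A' B' y by blast
    show "card ?C = n" using A' x y fin
      by (metis Diff_iff Diff_insert_absorb card_Suc_Diff1 card_insert_disjoint finite_Diff)
    fix k assume k: "k \<le> 2 * n"
    show "k \<le> 2 * card (?C \<inter> {1..k})"
    proof (cases "k < y")
      case True
      have "B \<inter> {1..k} \<subseteq> ?C \<inter> {1..k}"
      proof
        fix z assume "z \<in> B \<inter> {1..k}"
        then show "z \<in> ?C \<inter> {1..k}" using ymin[of z] True x by force
      qed
      then have "card (B \<inter> {1..k}) \<le> card (?C \<inter> {1..k})" by (intro card_mono) auto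
      then show ?thesis using B' k by (meson le_trans mult_le_mono2)
    next
      case False
      have y1: "1 \<le> y" using y B' by force
      have ci: "card (insert z T) \<le> Suc (card T)" if "finite T" for z and T :: "nat set"
        using that by (simp add: card_insert_if)
      have "card (A \<inter> {1..k}) \<le> card (insert x (A \<inter> {1..k} - {x}))"
        using fin by (intro card_mono) auto
      also have "\<dots> \<le> Suc (card (A \<inter> {1..k} - {x}))"
        by (rule ci) (use fin in simp)
      also have "\<dots> = card (insert y (A \<inter> {1..k} - {x}))"
        using y by simp
      also have "insert y (A \<inter> {1..k} - {x}) = ?C \<inter> {1..k}"
        using False y1 by auto
      finally have "card (A \<inter> {1..k}) \<le> card (?C \<inter> {1..k})" .
      then show ?thesis using A' k by (meson le_trans mult_le_mono2)
    qed
  qed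
  then show "\<exists>y\<in>B - A. insert y (A - {x}) \<in> bases (catalan_matroid n)" using y by blast
qed

context vector_space
begin

lemma indep_family_insert:
  assumes "i \<notin> J"
  shows "indep_family scale v (insert i J) \<longleftrightarrow> indep_family scale v J \<and> v i \<notin> span (v ` J)"
proof (cases "v i \<in> v ` J")
  case True
  then have "v i \<in> span (v ` J)" by (rule span_base)
  moreover have "\<not> inj_on v (insert i J)" using True assms by (simp add: inj_on_insert)
  ultimately show ?thesis by (simp add: indep_family_def)
next
  case False
  have "inj_on v (insert i J) \<longleftrightarrow> inj_on v J" using False assms by (simp add: inj_on_insert)
  moreover have "independent (v ` insert i J) \<longleftrightarrow> independent (v ` J) \<and> v i \<notin> span (v ` J)"
    using False by (simp only: image_insert independent_insert if_False)
  ultimately show ?thesis by (simp only: indep_family_def) blast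
qed

lemma vector_matroid_bases_iff:
  "J \<in> bases (vector_matroid scale I v) \<longleftrightarrow>
     J \<subseteq> I \<and> indep_family scale v J \<and> v ` I \<subseteq> span (v ` J)"
proof (intro iffI conjI)
  assume "J \<in> bases (vector_matroid scale I v)"
  then have J: "J \<subseteq> I" and ind: "indep_family scale v J"
    and max: "\<And>J'. J' \<subseteq> I \<Longrightarrow> indep_family scale v J' \<Longrightarrow> J \<subseteq> J' \<Longrightarrow> J' = J"
    by (simp_all add: vector_matroid_def)
  show "J \<subseteq> I" "indep_family scale v J" by fact+
  show "v ` I \<subseteq> span (v ` J)"
  proof (rule image_subsetI)
    fix i assume i: "i \<in> I"
    show "v i \<in> span (v ` J)"
    proof (rule ccontr)
      assume n: "v i \<notin> span (v ` J)"
      have iJ: "i \<notin> J"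
      proof
        assume "i \<in> J"
        then have "v i \<in> span (v ` J)" by (intro span_base imageI)
        then show False using n by contradiction
      qed
      have "indep_family scale v (insert i J)"
        using n ind by (simp add: indep_family_insert[OF iJ])
      then have "insert i J = J"
        using J i by (intro max) auto
      then show False using iJ by blast
    qed
  qed
next
  assume "J \<subseteq> I \<and> indep_family scale v J \<and> v ` I \<subseteq> span (v ` J)"
  then have J: "J \<subseteq> I" "indep_family scale v J" "v ` I \<subseteq> span (v ` J)" by simp_all
  have "J' = J" if J': "J' \<subseteq> I" "indep_family scale v J'" "J \<subseteq> J'" for J'
  proof (rule ccontr)
    assume "J' \<noteq> J"
    then obtain i where i: "i \<in> J'" "i \<notin> J" using J'(3) by blast
    have "indep_family scale v (insert i (J' - {i}))"
      using J'(2) i(1) by (simp add: insert_absorb)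
    then have "v i \<notin> span (v ` (J' - {i}))" by (subst (asm) indep_family_insert) simp_all
    moreover have "span (v ` J) \<subseteq> span (v ` (J' - {i}))"
      using J'(3) i by (intro span_mono image_mono) blast
    moreover have "v i \<in> span (v ` J)"
      using J(3) J'(1) i(1) by (meson image_subset_iff subsetD)
    ultimately show False by (meson subsetD)
  qed
  then show "J \<in> bases (vector_matroid scale I v)"
    using J(1,2) by (simp add: vector_matroid_def)
qed

lemma is_matroid_vector_matroid:
  assumes "finite I"
  shows "is_matroid (vector_matroid scale I v)"
  unfolding is_matroid_def
proof (intro conjI ballI)
  let ?M = "vector_matroid scale I v"
  show "finite (ground ?M)" using assms by (simp add: vector_matroid_def)
  show "bases ?M \<subseteq> Pow (ground ?M)"
    by (rule subsetI) (simp add: vector_matroid_def)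
  let ?S = "{J. J \<subseteq> I \<and> indep_family scale v J}"
  have "finite ?S" by (rule finite_subset[of _ "Pow I"]) (use assms in auto)
  moreover have "{} \<in> ?S" by (simp add: indep_family_def independent_empty)
  then have "?S \<noteq> {}" by (simp only: ex_in_conv[symmetric]) (rule exI)
  ultimately have "\<exists>J\<in>?S. \<forall>J'\<in>?S. J \<subseteq> J' \<longrightarrow> J = J'"
    by (rule finite_has_maximal)
  then obtain J where J: "J \<in> ?S" "\<And>J'. J' \<in> ?S \<Longrightarrow> J \<subseteq> J' \<Longrightarrow> J = J'"
    by meson
  have "J' = J" if "J' \<subseteq> I" "indep_family scale v J'" "J \<subseteq> J'" for J'
    using J(2)[of J'] that by simp
  then have "J \<in> bases ?M"
    using J(1) by (simp add: vector_matroid_def)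
  then show "bases ?M \<noteq> {}" by (simp only: ex_in_conv[symmetric]) (rule exI)
next
  let ?M = "vector_matroid scale I v"
  fix A B x
  assume "A \<in> bases ?M" and "B \<in> bases ?M" and "x \<in> A - B"
  then have A: "A \<subseteq> I" "indep_family scale v A" "v ` I \<subseteq> span (v ` A)"
    and B: "B \<subseteq> I" "v ` I \<subseteq> span (v ` B)" and x: "x \<in> A" "x \<notin> B"
    by (simp_all add: vector_matroid_bases_iff)
  have A_eq: "insert x (A - {x}) = A" using x(1) by (rule insert_Diff)
  have Ax: "indep_family scale v (A - {x})" "v x \<notin> span (v ` (A - {x}))"
    using A(2) indep_family_insert[of x "A - {x}" v] unfolding A_eq by simp_all
  have "\<not> v ` B \<subseteq> span (v ` (A - {x}))"
  proof
    assume "v ` B \<subseteq> span (v ` (A - {x}))"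
    then have "span (v ` B) \<subseteq> span (v ` (A - {x}))" by (intro span_minimal subspace_span)
    moreover have "v x \<in> span (v ` B)"
      using B(2) A(1) x(1) by (meson image_subset_iff subsetD)
    ultimately show False using Ax(2) by (meson subsetD)
  qed
  then obtain y where y: "y \<in> B" "v y \<notin> span (v ` (A - {x}))"
    by (meson image_subsetI)
  have yA: "y \<notin> A - {x}"
  proof
    assume "y \<in> A - {x}"
    then have "v y \<in> span (v ` (A - {x}))" by (intro span_base imageI)
    then show False using y(2) by contradiction
  qed
  let ?C = "insert y (A - {x})"
  have "indep_family scale v ?C" using Ax(1) y(2) by (simp only: indep_family_insert[OF yA] simp_thms)
  moreover have "?C \<subseteq> I" using A(1) B(1) y(1) by blast
  moreover have "v ` I \<subseteq> span (v ` ?C)"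
  proof -
    have vA: "v ` A = insert (v x) (v ` (A - {x}))"
      by (metis A_eq image_insert)
    have "v y \<in> span (v ` A)"
      using A(3) B(1) y(1) by (meson image_subset_iff subsetD)
    then have "v x \<in> span (insert (v y) (v ` (A - {x})))"
      unfolding vA by (rule in_span_insert) (rule y(2))
    moreover have "v ` (A - {x}) \<subseteq> span (insert (v y) (v ` (A - {x})))"
      by (meson span_superset subset_insertI subset_trans)
    ultimately have "v ` A \<subseteq> span (v ` ?C)"
      unfolding vA image_insert by (rule insert_subsetI)
    then have "span (v ` A) \<subseteq> span (v ` ?C)" by (intro span_minimal subspace_span)
    then show ?thesis using A(3) by (rule subset_trans[rotated])
  qed
  ultimately have C: "?C \<in> bases ?M" unfolding vector_matroid_bases_iff by (intro conjI)
  have "y \<in> B - A" using y(1) yA x(2) by blast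
  then show "\<exists>y\<in>B - A. insert y (A - {x}) \<in> bases ?M" using C by (rule bexI[rotated])
qed

end

end

(* The sets {1..n-2} \<union> {x,y} with x \<noteq> y in {n-1..2n-2} are all bases of the Catalan matroid, so
   contracting {1..n-2} and restricting to {n-1..2n-2} gives the uniform matroid U(2,n). Over a
   field with q elements a plane has only q + 1 lines through the origin, so a representation
   forces n \<le> q + 1. *)
theory Submission
  imports Defs
begin

context vector_space
begin

text \<open>Modulo \<open>span S\<close> the vectors \<open>w z\<close> lie in a plane and are
  pairwise non-proportional, and all but one of them can be labelled injectively by scalars. Keeping
  \<open>S\<close> inside every span stands in for passing to the quotient space.\<close>

lemma card_pairwise_independent_mod_span_le:
  fixes w :: "'i \<Rightarrow> 'b"
  assumes fin: "finite (UNIV :: 'a set)"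
    and spanning: "\<And>x y z. x \<in> T \<Longrightarrow> y \<in> T \<Longrightarrow> x \<noteq> y \<Longrightarrow> z \<in> T \<Longrightarrow>
        w z \<in> span (insert (w x) (insert (w y) S))"
    and indep: "\<And>x y. x \<in> T \<Longrightarrow> y \<in> T \<Longrightarrow> x \<noteq> y \<Longrightarrow> w x \<notin> span (insert (w y) S)"
  shows "card T \<le> Suc CARD('a)"
proof (cases "\<exists>p\<in>T. \<exists>r\<in>T. r \<noteq> p")
  case False
  then have "\<And>x y. x \<in> T \<Longrightarrow> y \<in> T \<Longrightarrow> x = y" by blast
  then show ?thesis
    by (metis One_nat_def Suc_le_mono card_le_Suc0_iff_eq card.infinite le_Suc_eq le_trans zero_le)
next
  case True
  then obtain p r where p: "p \<in> T" and r: "r \<in> T" and rp: "r \<noteq> p" by blast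
  \<comment> \<open>Modulo \<open>span S\<close>, the line through \<open>w z\<close> contains exactly one point of the
    form \<open>w r - c w p\<close>; the coefficient \<open>c\<close> determines \<open>z\<close>.\<close>
  have "\<exists>c b. w r - scale c (w p) - scale b (w z) \<in> span S" if "z \<in> T - {p}" for z
    using spanning[of p z r] that p r by (auto simp: span_breakdown_eq)
  then obtain c b where cb: "\<And>z. z \<in> T - {p} \<Longrightarrow> w r - scale (c z) (w p) - scale (b z) (w z) \<in> span S"
    by metis
  have b0: "b z \<noteq> 0" if z: "z \<in> T - {p}" for z
  proof
    assume "b z = 0"
    then have "w r - scale (c z) (w p) \<in> span S" using cb[OF z] by simp
    then have "w r \<in> span (insert (w p) S)" unfolding span_breakdown_eq by blast
    then show False using indep[OF r p rp] by contradiction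
  qed
  \<comment> \<open>For equal coefficients, subtracting the two relations cancels \<open>w r\<close>
    and \<open>w p\<close>; since \<open>b x\<close> is invertible, \<open>w x\<close> is then a
    multiple of \<open>w y\<close> modulo \<open>span S\<close>.\<close>
  have "inj_on c (T - {p})"
  proof (rule inj_onI, rule ccontr)
    fix x y assume x: "x \<in> T - {p}" and y: "y \<in> T - {p}" and eq: "c x = c y" and ne: "x \<noteq> y"
    have "(w r - scale (c y) (w p) - scale (b y) (w y)) - (w r - scale (c x) (w p) - scale (b x) (w x))
        \<in> span S"
      using cb[OF y] cb[OF x] by (rule span_diff)
    then have "scale (b x) (w x) - scale (b y) (w y) \<in> span S" by (simp add: eq)
    then have "scale (inverse (b x)) (scale (b x) (w x) - scale (b y) (w y)) \<in> span S"
      by (rule span_scale)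
    then have "w x - scale (inverse (b x) * b y) (w y) \<in> span S"
      using b0[OF x] by (simp add: scale_right_diff_distrib)
    then have "w x \<in> span (insert (w y) S)" unfolding span_breakdown_eq by blast
    then show False using indep[of x y] x y ne by blast
  qed
  then have "card (T - {p}) \<le> CARD('a)" using fin by (intro card_inj_on_le) auto
  then show ?thesis by (simp add: card_Diff_singleton p)
qed

end

lemma initial_segment_with_pair_in_catalan_bases:
  assumes "n \<ge> 2" "x \<in> {n - 1..2 * n - 2}" "y \<in> {n - 1..2 * n - 2}" "x \<noteq> y"
  shows "insert x (insert y {1..n - 2}) \<in> bases (catalan_matroid n)"
proof -
  \<comment> \<open>By symmetry let \<open>x < y\<close>. Then \<open>x \<le> 2 * n - 3\<close>, so
    a prefix ending before \<open>x\<close> has length at most \<open>2 * (n - 2)\<close>, which the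
    initial up-steps balance; one ending before \<open>y\<close> has length at most
    \<open>2 * (n - 1) - 1\<close>.\<close>
  have *: "insert x (insert y {1..n - 2}) \<in> bases (catalan_matroid n)"
    if x: "n - 1 \<le> x" and xy: "x < y" and y: "y \<le> 2 * n - 2" for x y
    unfolding catalan_bases_iff
  proof (intro conjI allI impI)
    let ?X = "insert x (insert y {1..n - 2})"
    show "?X \<subseteq> {1..2 * n}" using x xy y assms(1) by auto
    show "card ?X = n" using x xy y assms(1) by (auto simp: card_insert_if)
    fix k assume k: "k \<le> 2 * n"
    consider "k < x" | "x \<le> k" "k < y" | "y \<le> k" by linarith
    then show "k \<le> 2 * card (?X \<inter> {1..k})"
    proof cases
      case 1
      then have "?X \<inter> {1..k} = {1..min (n - 2) k}" using x xy by auto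
      then show ?thesis using 1 xy y by simp
    next
      case 2
      then have "?X \<inter> {1..k} = insert x {1..n - 2}" using x xy assms(1) by auto
      then have "card (?X \<inter> {1..k}) = n - 1" using x xy assms(1) by (auto simp: card_insert_if)
      then show ?thesis using 2 y by simp
    next
      case 3
      then have "?X \<inter> {1..k} = ?X" using x xy assms(1) by auto
      then show ?thesis using k \<open>card ?X = n\<close> by simp
    qed
  qed
  show ?thesis
  proof (cases "x < y")
    case True
    then show ?thesis using *[of x y] assms by simp
  next
    case False
    then show ?thesis using *[of y x] assms by (simp add: insert_commute)
  qed
qed

theorem proposition5p3:
  fixes n q :: nat
  assumes "n > 0"
    and "CARD('k::{field,finite}) = q"
    and "int q \<le> int n - 2"
  shows "\<not> representable_over TYPE('k) TYPE('v::ab_group_add) (catalan_matroid n)"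
proof
  assume "representable_over TYPE('k) TYPE('v) (catalan_matroid n)"
  then obtain scale :: "'k \<Rightarrow> 'v \<Rightarrow> 'v" and I and v :: "nat \<Rightarrow> 'v"
    where "vector_space scale" and "matroid_iso (catalan_matroid n) (vector_matroid scale I v)"
    unfolding representable_over_def by blast
  then interpret vector_space scale by simp
  obtain f where bij: "bij_betw f {1..2 * n} I"
    and iso: "\<And>X. X \<subseteq> {1..2 * n} \<Longrightarrow>
      X \<in> bases (catalan_matroid n) \<longleftrightarrow> f ` X \<in> bases (vector_matroid scale I v)"
    using \<open>matroid_iso _ _\<close>
    by (auto simp: matroid_iso_def catalan_matroid_def vector_matroid_def)
  \<comment> \<open>This makes the natural-number differences \<open>n - 1\<close> and
    \<open>n - 2\<close> exact, so that \<open>?T\<close> has \<open>n\<close> elements.\<close>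
  have n: "n \<ge> 2" using assms(3) by linarith
  let ?S = "{1..n - 2}" and ?T = "{n - 1..2 * n - 2}"
  let ?P = "v ` f ` ?S"
  \<comment> \<open>Independence and spanning of this one basis supply the two hypotheses of the
    counting lemma.\<close>
  have basis: "indep_family scale v (f ` insert x (insert y ?S))"
    "v ` I \<subseteq> span (v ` f ` insert x (insert y ?S))"
    if "x \<in> ?T" "y \<in> ?T" "x \<noteq> y" for x y
  proof -
    have B: "insert x (insert y ?S) \<in> bases (catalan_matroid n)"
      using initial_segment_with_pair_in_catalan_bases[OF n that] .
    then have "insert x (insert y ?S) \<subseteq> {1..2 * n}" unfolding catalan_bases_iff by blast
    then have "f ` insert x (insert y ?S) \<in> bases (vector_matroid scale I v)"
      using B by (simp only: iso)
    then show "indep_family scale v (f ` insert x (insert y ?S))"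
      "v ` I \<subseteq> span (v ` f ` insert x (insert y ?S))"
      unfolding vector_matroid_bases_iff by blast+
  qed
  have "card ?T \<le> Suc CARD('k)"
  proof (rule card_pairwise_independent_mod_span_le[where w = "\<lambda>i. v (f i)" and S = ?P])
    fix x y z assume xyz: "x \<in> ?T" "y \<in> ?T" "x \<noteq> y" "z \<in> ?T"
    have "z \<in> {1..2 * n}" using xyz(4) n by auto
    with bij have "f z \<in> I" by (rule bij_betw_apply)
    then show "v (f z) \<in> span (insert (v (f x)) (insert (v (f y)) ?P))"
      using basis(2)[OF xyz(1-3)] by (metis image_insert image_subset_iff)
  next
    fix x y assume xy: "x \<in> ?T" "y \<in> ?T" "x \<noteq> y"
    \<comment> \<open>\<open>indep_family_insert\<close> splits off only a new index; injectivity of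
      \<open>f\<close> ensures that \<open>f x\<close> is one.\<close>
    have "f x \<notin> f ` insert y ?S"
    proof
      assume "f x \<in> f ` insert y ?S"
      then have "x \<in> insert y ?S"
        using xy n bij by (subst (asm) inj_on_image_mem_iff[of f "{1..2 * n}"]) (auto simp: bij_betw_def)
      then show False using xy n by auto
    qed
    then show "v (f x) \<notin> span (insert (v (f y)) ?P)"
      using basis(1)[OF xy] indep_family_insert by (metis image_insert)
  qed simp
  moreover have "card ?T = n" using n by simp
  ultimately show False using assms(2,3) by simp
qed

end
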